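(* Let $\alpha>0$, let $\Lambda$ be a Young diagram with $n\ge1$ boxes, let $y_1(\alpha)<\dots<y_{d-1}(\alpha)$ be the $\alpha$-contents of the removable boxes of $\Lambda$ and $x_1(\alpha)<\dots<x_d(\alpha)$ the $\alpha$-contents of the addable boxes of $\Lambda$ (these interlace: $x_1(\alpha)<y_1(\alpha)<x_2(\alpha)<\dots<y_{d-1}(\alpha)<x_d(\alpha)$), and put $A(\alpha)=\alpha n$. Fix $k$ and let $\lambda$ be obtained from $\Lambda$ by erasing the removable box of $\alpha$-content $y_k(\alpha)$. Then $$\frac{\varkappa_\alpha(\lambda,\Lambda)\dim_\alpha\lambda}{\dim_\alpha\Lambda}=\frac{(x_d(\alpha)-y_k(\alpha))(y_k(\alpha)-x_1(\alpha))}{A(\alpha)}\prod_{i=1}^{k-1}\frac{y_k(\alpha)-x_{i+1}(\alpha)}{y_k(\alpha)-y_i(\alpha)}\prod_{j=k+1}^{d-1}\frac{y_k(\alpha)-x_j(\alpha)}{y_k(\alpha)-y_j(\alpha)}.$$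
   Context: Young diagrams are sets of boxes $(i,j)$ (row $i$, column $j$); $\lambda'$ is the conjugate. For $b=(i,j)\in\lambda$, the arm length is $a(b)=\lambda_i-j$ and the leg length is $l(b)=\lambda'_j-i$. Write $\lambda\nearrow\Lambda$ if $\Lambda$ is obtained from $\lambda$ by adding one box. If the new box lies in column $j$, define $$\varkappa_\alpha(\lambda,\Lambda)=\prod_{b}\frac{(a(b)\alpha+l(b)+2)(a(b)\alpha+l(b)+1)}{((a(b)+1)\alpha+l(b)+1)(a(b)\alpha+l(b)+1)},$$ the product over all boxes $b$ of $\lambda$ in column $j$ (arm and leg lengths taken in $\lambda$). (These are the coefficients in $p_1P_\lambda=\sum_{\lambda\nearrow\Lambda}\varkappa_\alpha(\lambda,\Lambda)P_\Lambda$ for Jack polynomials $P_\lambda(x;\alpha)$.) Define $\dim_\alpha\varnothing=1$ and recursively $\dim_\alpha\Lambda=\sum_{\lambda:\lambda\nearrow\Lambda}\varkappa_\alpha(\lambda,\Lambda)\dim_\alpha\lambda$. The $\alpha$-content of a removable box $(i,j)$ (that of its south-east corner point) is $j\alpha-i$; the $\alpha$-content of an addable box $(i,j)$ (that of its north-west corner point) is $(j-1)\alpha-(i-1)$. Removable boxes are boxes whose removal leaves a Young diagram; addable boxes are boxes outside the diagram whose addition gives a Young diagram.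
   Formalization: In ϰ_α the numerator factor a(b)α+l(b)+1 is replaced by (a(b)+1)α+l(b), the Jack Pieri coefficient; with the printed factor the claim fails, e.g. Λ=(2,1), λ=(2), α=2 gives 6/11 on the left and 4/9 on the right. *)

theory Defs
  imports Complex_Main
begin

text \<open>
  A box is a pair \<open>(i, j)\<close> of a row index and a column index, both counted from 1.
\<close>

type_synonym box = "nat \<times> nat"

definition young_diagram :: "box set \<Rightarrow> bool" where
  "young_diagram L \<longleftrightarrow> finite L \<and> (\<forall>(i, j) \<in> L. 1 \<le> i \<and> 1 \<le> j) \<and>
     (\<forall>i j i' j'. (i, j) \<in> L \<and> 1 \<le> i' \<and> i' \<le> i \<and> 1 \<le> j' \<and> j' \<le> j \<longrightarrow> (i', j') \<in> L)"

definition row_length :: "box set \<Rightarrow> nat \<Rightarrow> nat" where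
  "row_length L i = card {j. (i, j) \<in> L}"

definition col_length :: "box set \<Rightarrow> nat \<Rightarrow> nat" where
  "col_length L j = card {i. (i, j) \<in> L}"

definition arm :: "box set \<Rightarrow> box \<Rightarrow> real" where
  "arm L b = real (row_length L (fst b)) - real (snd b)"

definition leg :: "box set \<Rightarrow> box \<Rightarrow> real" where
  "leg L b = real (col_length L (snd b)) - real (fst b)"

definition adds_box :: "box set \<Rightarrow> box set \<Rightarrow> bool" where
  "adds_box M L \<longleftrightarrow> young_diagram M \<and> young_diagram L \<and> (\<exists>b. b \<notin> M \<and> L = insert b M)"

text \<open>
  The coefficient of \<open>P\<^sub>L\<close> in \<open>p\<^sub>1 P\<^sub>M\<close> for Jack polynomials with parameter \<open>\<alpha>\<close>.
  The second factor of the numerator is \<open>(a + 1) \<alpha> + l\<close>, as in the Pieri formula.  The source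
  prints \<open>a \<alpha> + l + 1\<close> there; the two agree at \<open>\<alpha> = 1\<close>, but the printed version is not the
  Pieri coefficient: for \<open>M\<close> a single box and \<open>L\<close> a column of two boxes it gives
  \<open>2 / (\<alpha> + 1)\<close>, whereas \<open>p\<^sub>1\<^sup>2 = P\<^bsub>(2)\<^esub> + (2 \<alpha> / (\<alpha> + 1)) P\<^bsub>(1,1)\<^esub>\<close>.  With the printed
  version the product formula for \<open>kappa \<alpha> M L * dim_alpha \<alpha> M / dim_alpha \<alpha> L\<close> fails, e.g. for \<open>L\<close> the
  diagram (2,1), \<open>M\<close> the diagram (2) and \<open>\<alpha> = 2\<close> (6/11 against 4/9).

  The set \<open>L - M\<close> is a singleton, consisting of the new box, whenever \<open>adds_box M L\<close>.
\<close>

definition kappa :: "real \<Rightarrow> box set \<Rightarrow> box set \<Rightarrow> real" where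
  "kappa \<alpha> M L =
     (\<Prod>b \<in> {b \<in> M. snd b = snd (the_elem (L - M))}.
        ((arm M b * \<alpha> + leg M b + 2) * ((arm M b + 1) * \<alpha> + leg M b)) /
        (((arm M b + 1) * \<alpha> + leg M b + 1) * (arm M b * \<alpha> + leg M b + 1)))"

function dim_alpha :: "real \<Rightarrow> box set \<Rightarrow> real" where
  "dim_alpha \<alpha> L =
     (if L = {} then 1 else (\<Sum>M \<in> {M. adds_box M L}. kappa \<alpha> M L * dim_alpha \<alpha> M))"
  by auto
termination
  by (relation "measure (\<lambda>(\<alpha>, L). card L)") (auto simp: adds_box_def young_diagram_def)

declare dim_alpha.simps [simp del]

definition removable :: "box set \<Rightarrow> box set" where
  "removable L = {b \<in> L. young_diagram (L - {b})}"

definition addable :: "box set \<Rightarrow> box set" where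
  "addable L = {b. b \<notin> L \<and> young_diagram (insert b L)}"

text \<open>Content of the south-east corner point of a box, used for removable boxes.\<close>

definition se_content :: "real \<Rightarrow> box \<Rightarrow> real" where
  "se_content \<alpha> b = real (snd b) * \<alpha> - real (fst b)"

text \<open>Content of the north-west corner point of a box, used for addable boxes.\<close>

definition nw_content :: "real \<Rightarrow> box \<Rightarrow> real" where
  "nw_content \<alpha> b = (real (snd b) - 1) * \<alpha> - (real (fst b) - 1)"

text \<open>
  The \<open>k\<close>-th smallest content, counted from \<open>k = 1\<close>, of the removable (\<open>y_seq\<close>) and
  addable (\<open>x_seq\<close>) boxes.
\<close>

definition y_seq :: "real \<Rightarrow> box set \<Rightarrow> nat \<Rightarrow> real" where
  "y_seq \<alpha> L k = sorted_list_of_set (se_content \<alpha> ` removable L) ! (k - 1)"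

definition x_seq :: "real \<Rightarrow> box set \<Rightarrow> nat \<Rightarrow> real" where
  "x_seq \<alpha> L k = sorted_list_of_set (nw_content \<alpha> ` addable L) ! (k - 1)"

end

theory Submission
  imports Defs
begin

text \<open>
  Write \<open>N\<close> for the number of rows of \<open>L\<close>, \<open>h\<^sub>i\<close> for the length of row \<open>i\<close>,
  \<open>u\<^sub>i = \<alpha> h\<^sub>i - (i - 1)\<close> and \<open>v\<^sub>i = \<alpha> h\<^sub>i - i\<close>.  The contents \<open>y\<close> are the \<open>v\<^sub>r\<close> and the
  contents \<open>x\<close> are \<open>u\<^sub>1\<close> and the \<open>u\<^bsub>r + 1\<^esub>\<close>, where \<open>r\<close> runs over the rows with
  \<open>h\<^bsub>r + 1\<^esub> < h\<^sub>r\<close>; for all other rows \<open>u\<^bsub>i + 1\<^esub> = v\<^sub>i\<close>, so that such rows cancel in products.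

  Let \<open>H(L)\<close> be the product of the upper hook lengths \<open>(a + 1) \<alpha> + l\<close>.  If \<open>M\<close> arises from \<open>L\<close> by
  erasing the corner in row \<open>r\<close>, then \<open>w\<^sub>r = kappa(M, L) H(L) / H(M)\<close> is a product over the boxes
  above and to the left of the corner.  The first factor is already a product over rows; the
  second becomes one because a telescoping product over the boxes below row \<open>r\<close> can be evaluated
  by rows or by columns.  The result is
  \<open>w\<^sub>r = (v\<^sub>r + N) \<Prod>\<^bsub>i \<noteq> r\<^esub> (v\<^sub>r - u\<^sub>i) / (v\<^sub>r - v\<^sub>i)\<close>, the negative of a term of a divided
  difference of a monic polynomial of degree \<open>N + 1\<close>.  Evaluating that divided difference gives
  \<open>\<Sum>\<^sub>r w\<^sub>r = \<alpha> |L|\<close>, whence \<open>dim_alpha \<alpha> L = |L|! \<alpha>\<^bsup>|L|\<^esup> / H(L)\<close> by induction, and the ratio in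
  question is \<open>w\<^sub>r / (\<alpha> |L|)\<close>.
\<close>

subsection \<open>Divided differences\<close>

text \<open>For \<open>v\<close> injective on \<open>I\<close> this is the Lagrange form of the
  divided difference of \<open>f\<close> at the nodes \<open>v i\<close>. In this form the symmetry
  in the nodes is evident, and sums over rows can be recognised as divided differences.\<close>

definition divdiff :: "('i \<Rightarrow> 'a::field) \<Rightarrow> 'i set \<Rightarrow> ('a \<Rightarrow> 'a) \<Rightarrow> 'a" where
  "divdiff v I f = (\<Sum>i\<in>I. f (v i) / (\<Prod>j\<in>I - {i}. v i - v j))"

lemma divdiff_add: "divdiff v I (\<lambda>z. f z + g z) = divdiff v I f + divdiff v I g"
  by (simp add: divdiff_def add_divide_distrib sum.distrib)

lemma divdiff_cmult: "divdiff v I (\<lambda>z. c * f z) = c * divdiff v I f"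
  by (simp add: divdiff_def sum_distrib_left)

text \<open>The factor \<open>z - v k\<close> kills the term of the new node and cancels the factor
  which that node adds to every other denominator.\<close>

lemma divdiff_insert_mult:
  assumes "finite I" "k \<notin> I" "inj_on v (insert k I)"
  shows "divdiff v (insert k I) (\<lambda>z. (z - v k) * f z) = divdiff v I f"
proof -
  have "(v i - v k) * f (v i) / (\<Prod>j\<in>insert k I - {i}. v i - v j) =
      f (v i) / (\<Prod>j\<in>I - {i}. v i - v j)" if "i \<in> I" for i
  proof -
    have "insert k I - {i} = insert k (I - {i})" "k \<notin> I - {i}" "v i \<noteq> v k"
      using assms that by (auto simp: inj_on_def)
    then show ?thesis using assms(1) by simp
  qed
  then show ?thesis using assms(1,2) by (simp add: divdiff_def)
qed

text \<open>Leibniz rule for a linear factor, from the splitting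
  \<open>z - a = (z - v k) + (v k - a)\<close>. It drives the evaluations below, each by induction
  on the set of nodes.\<close>

lemma divdiff_shift:
  assumes "finite I" "k \<notin> I" "inj_on v (insert k I)"
  shows "divdiff v (insert k I) (\<lambda>z. (z - a) * f z) =
    divdiff v I f + (v k - a) * divdiff v (insert k I) f"
proof -
  have "(\<lambda>z. (z - a) * f z) = (\<lambda>z. (z - v k) * f z + (v k - a) * f z)"
    by (simp add: algebra_simps)
  then show ?thesis
    using divdiff_insert_mult[OF assms, of f] by (simp add: divdiff_add divdiff_cmult)
qed

text \<open>The polynomial is monic of degree one less than the number of nodes, so only its leading
  coefficient survives.\<close>

lemma divdiff_prod_insert:
  assumes "finite I" "k \<notin> I" "inj_on v (insert k I)"
  shows "divdiff v (insert k I) (\<lambda>z. \<Prod>i\<in>I. z - g i) = 1"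
  using assms
proof (induction I arbitrary: k)
  case empty
  then show ?case by (simp add: divdiff_def)
next
  case (insert l I)
  let ?P = "\<lambda>z. \<Prod>i\<in>I. z - g i"
  let ?D = "divdiff v (insert k (insert l I)) ?P"
  have comm: "insert l (insert k I) = insert k (insert l I)" by auto
  have inj: "inj_on v (insert k I)" "inj_on v (insert l I)" "inj_on v (insert l (insert k I))"
    using insert.prems(2) by (auto simp: inj_on_def)
  have k: "divdiff v (insert k I) ?P = 1"
    using insert inj by auto
  have l: "divdiff v (insert l I) ?P = 1"
    using insert inj by auto
  have s: "divdiff v (insert k (insert l I)) (\<lambda>z. (z - a) * ?P z) = 1 + (v l - a) * ?D" for a
    using divdiff_shift[of "insert k I" l v a ?P] insert inj k by (auto simp: comm)
  \<comment> \<open>The case \<open>a = v k\<close> of \<open>s\<close> is evaluated again by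
    deleting the node \<open>k\<close> instead of \<open>l\<close>. Comparing the two values forces
    \<open>?D = 0\<close>, which says that a degree two below the number of nodes gives
    zero.\<close>
  have "divdiff v (insert k (insert l I)) (\<lambda>z. (z - v k) * ?P z) = 1"
    using divdiff_insert_mult[of "insert l I" k v ?P] insert l by auto
  moreover have "v l \<noteq> v k" using insert by (auto simp: inj_on_def)
  ultimately have "?D = 0" using s[of "v k"] by simp
  then show ?case using s[of "g l"] insert by simp
qed

text \<open>One degree higher, the value is the sum of the nodes minus the sum of the roots.\<close>

lemma divdiff_prod:
  assumes "finite I" "inj_on v I"
  shows "divdiff v I (\<lambda>z. \<Prod>i\<in>I. z - g i) = (\<Sum>i\<in>I. v i - g i)"
  using assms
proof (induction I)
  case empty
  then show ?case by (simp add: divdiff_def)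
next
  case (insert k I)
  then show ?case
    using divdiff_shift[of I k v "g k" "\<lambda>z. \<Prod>i\<in>I. z - g i"] divdiff_prod_insert[of I k v g]
    by (simp add: add.commute)
qed

text \<open>Two degrees above the trivial case, the value is the complete homogeneous function of
  degree 2 in nodes minus roots. The right-hand side is \<open>2 * h_2 = p_1^2 + p_2\<close>, where
  a power sum \<open>p_j\<close> counts nodes positively and the roots \<open>g i\<close> and
  \<open>a\<close> negatively.\<close>

lemma divdiff_prod_linear:
  fixes v :: "'i \<Rightarrow> 'a::field"
  assumes "finite I" "inj_on v I"
  shows "2 * divdiff v I (\<lambda>z. (z - a) * (\<Prod>i\<in>I. z - g i)) =
    ((\<Sum>i\<in>I. v i - g i) - a)\<^sup>2 + (\<Sum>i\<in>I. (v i)\<^sup>2 - (g i)\<^sup>2) - a\<^sup>2"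
  using assms
proof (induction I)
  case empty
  then show ?case by (simp add: divdiff_def)
next
  case (insert k I)
  let ?P = "\<lambda>z. \<Prod>i\<in>I. z - g i"
  have i: "inj_on v I" using insert by auto
  have "divdiff v (insert k I) (\<lambda>z. (z - g k) * ((z - a) * ?P z)) =
      divdiff v I (\<lambda>z. (z - a) * ?P z) + (v k - g k) * ((\<Sum>i\<in>I. v i - g i) + (v k - a))"
    using insert divdiff_shift[of I k v "g k" "\<lambda>z. (z - a) * ?P z"] divdiff_shift[of I k v a ?P]
      divdiff_prod_insert[of I k v g] divdiff_prod[OF insert(1) i, of g] by simp
  moreover have "(\<lambda>z. (z - a) * (\<Prod>i\<in>insert k I. z - g i)) =
      (\<lambda>z. (z - g k) * ((z - a) * ?P z))"
    using insert by (simp add: mult.left_commute)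
  ultimately have "2 * divdiff v (insert k I) (\<lambda>z. (z - a) * (\<Prod>i\<in>insert k I. z - g i)) =
      2 * divdiff v I (\<lambda>z. (z - a) * ?P z)
        + 2 * ((v k - g k) * ((\<Sum>i\<in>I. v i - g i) + (v k - a)))"
    by (simp only: distrib_left)
  also have "\<dots> = ((\<Sum>i\<in>insert k I. v i - g i) - a)\<^sup>2
      + (\<Sum>i\<in>insert k I. (v i)\<^sup>2 - (g i)\<^sup>2) - a\<^sup>2"
    unfolding insert.IH[OF i] sum.insert[OF insert.hyps] by algebra
  finally show ?case .
qed

section \<open>Telescoping products over the boxes of a diagram\<close>

lemma telescope_prod:
  fixes f :: "nat \<Rightarrow> 'a::field"
  assumes "\<And>i. i \<le> n \<Longrightarrow> f i \<noteq> 0"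
  shows "(\<Prod>i=1..n. f i / f (i - 1)) = f n / f 0"
  using assms by (induction n) auto

text \<open>
  Both sides equal \<open>G 0 0\<close> times the product, over the boxes \<open>(i, j)\<close> with \<open>j \<le> h i\<close>, of the
  cross ratio of the values of \<open>G\<close> at the four vertices of the box.
\<close>

lemma rows_eq_columns_prod:
  fixes G :: "nat \<Rightarrow> nat \<Rightarrow> 'a::field"
  assumes nz: "\<And>s t. s \<le> C \<Longrightarrow> t \<le> N \<Longrightarrow> G s t \<noteq> 0"
    and h: "\<And>i. i \<in> {1..N} \<Longrightarrow> h i \<le> C" and k: "\<And>j. j \<in> {1..C} \<Longrightarrow> k j \<le> N"
    and hk: "\<And>i j. i \<in> {1..N} \<Longrightarrow> j \<in> {1..C} \<Longrightarrow> j \<le> h i \<longleftrightarrow> i \<le> k j"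
  shows "(\<Prod>i=1..N. G (h i) (i - 1) / G (h i) i) * G 0 N =
    (\<Prod>j=1..C. G (j - 1) (k j) / G j (k j)) * G C 0"
proof -
  \<comment> \<open>\<open>b\<close> and \<open>c\<close> are one cross ratio grouped in two ways:
    \<open>b\<close> telescopes in \<open>j\<close> along a row, \<open>c\<close> in
    \<open>i\<close> along a column.\<close>
  define b where "b i j = (G j (i - 1) / G (j - 1) (i - 1)) / (G j i / G (j - 1) i)" for i j
  define c where "c i j = (G (j - 1) i / G (j - 1) (i - 1)) / (G j i / G j (i - 1))" for i j
  have bc: "b i j = c i j" for i j by (simp add: b_def c_def)
  have row: "(\<Prod>j=1..h i. b i j) = (G (h i) (i - 1) / G (h i) i) * (G 0 i / G 0 (i - 1))"
    if "i \<in> {1..N}" for i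
  proof -
    have "(\<Prod>j=1..h i. G j t / G (j - 1) t) = G (h i) t / G 0 t" if "t \<le> N" for t
      using telescope_prod[of "h i" "\<lambda>j. G j t"] h[OF \<open>i \<in> {1..N}\<close>] nz that by auto
    from this[of i] this[of "i - 1"] have "(\<Prod>j=1..h i. G j i / G (j - 1) i) = G (h i) i / G 0 i"
        "(\<Prod>j=1..h i. G j (i - 1) / G (j - 1) (i - 1)) = G (h i) (i - 1) / G 0 (i - 1)"
      using that by auto
    then show ?thesis
      using that prod_dividef[of "\<lambda>j. G j (i - 1) / G (j - 1) (i - 1)" "\<lambda>j. G j i / G (j - 1) i" "{1..h i}"]
      unfolding b_def by (simp only:) simp
  qed
  have col: "(\<Prod>i=1..k j. c i j) = (G (j - 1) (k j) / G j (k j)) * (G j 0 / G (j - 1) 0)"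
    if "j \<in> {1..C}" for j
  proof -
    have "(\<Prod>i=1..k j. G s i / G s (i - 1)) = G s (k j) / G s 0" if "s \<le> C" for s
      using telescope_prod[of "k j" "G s"] k[OF \<open>j \<in> {1..C}\<close>] nz that by auto
    from this[of j] this[of "j - 1"] have "(\<Prod>i=1..k j. G j i / G j (i - 1)) = G j (k j) / G j 0"
        "(\<Prod>i=1..k j. G (j - 1) i / G (j - 1) (i - 1)) = G (j - 1) (k j) / G (j - 1) 0"
      using that by auto
    then show ?thesis
      using that prod_dividef[of "\<lambda>i. G (j - 1) i / G (j - 1) (i - 1)" "\<lambda>i. G j i / G j (i - 1)" "{1..k j}"]
      unfolding c_def by (simp only:) simp
  qed
  have "(\<Prod>i=1..N. (G (h i) (i - 1) / G (h i) i) * (G 0 i / G 0 (i - 1))) =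
      (\<Prod>i=1..N. \<Prod>j=1..h i. b i j)"
    by (rule prod.cong[OF refl row[symmetric]])
  also have "\<dots> = (\<Prod>i=1..N. \<Prod>j | j \<in> {1..C} \<and> j \<le> h i. b i j)"
  proof (intro prod.cong refl)
    fix i assume "i \<in> {1..N}"
    then show "{1..h i} = {j. j \<in> {1..C} \<and> j \<le> h i}"
      using h[of i] by auto
  qed
  also have "\<dots> = (\<Prod>j=1..C. \<Prod>i | i \<in> {1..N} \<and> j \<le> h i. b i j)"
    by (rule prod.swap_restrict) auto
  also have "\<dots> = (\<Prod>j=1..C. \<Prod>i=1..k j. c i j)"
  proof (intro prod.cong refl bc)
    fix j assume j: "j \<in> {1..C}"
    then show "{i. i \<in> {1..N} \<and> j \<le> h i} = {1..k j}"
      using hk[OF _ j] k[OF j] by auto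
  qed
  also have "\<dots> = (\<Prod>j=1..C. (G (j - 1) (k j) / G j (k j)) * (G j 0 / G (j - 1) 0))"
    by (rule prod.cong[OF refl col])
  finally have eq: "(\<Prod>i=1..N. (G (h i) (i - 1) / G (h i) i) * (G 0 i / G 0 (i - 1))) = \<dots>" .
  \<comment> \<open>The surplus factors of rows and columns telescope along the two sides of the
    rectangle that meet at the origin.\<close>
  have "G 0 N = G 0 0 * (\<Prod>i=1..N. G 0 i / G 0 (i - 1))"
    "G C 0 = G 0 0 * (\<Prod>j=1..C. G j 0 / G (j - 1) 0)"
    using telescope_prod[of N "G 0"] telescope_prod[of C "\<lambda>j. G j 0"] nz by auto
  with eq show ?thesis
    unfolding prod.distrib by algebra
qed

subsection \<open>Corners of a Young diagram\<close>

lemma initial_segment_eq: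
  fixes S :: "nat set"
  assumes "finite S" "\<And>s. s \<in> S \<Longrightarrow> 1 \<le> s" "\<And>s t. s \<in> S \<Longrightarrow> 1 \<le> t \<Longrightarrow> t \<le> s \<Longrightarrow> t \<in> S"
  shows "S = {1..card S}"
proof (cases "S = {}")
  case False
  have eq: "S = {1..Max S}"
  proof (intro equalityI subsetI)
    fix s assume "s \<in> {1..Max S}"
    then show "s \<in> S" using assms(3)[OF Max_in[OF assms(1) False], of s] by simp
  next
    fix s assume "s \<in> S"
    then show "s \<in> {1..Max S}" using assms(2)[of s] Max_ge[OF assms(1), of s] by simp
  qed
  from arg_cong[OF eq, of card] have "Max S = card S" by simp
  from eq[unfolded this] show ?thesis .
qed auto

lemma young_diagram_downward:
  assumes "young_diagram L" "(i, j) \<in> L" "1 \<le> i'" "i' \<le> i" "1 \<le> j'" "j' \<le> j"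
  shows "(i', j') \<in> L"
  using assms unfolding young_diagram_def by blast

lemma young_diagram_pos:
  assumes "young_diagram L" "(i, j) \<in> L"
  shows "1 \<le> i" "1 \<le> j"
  using assms unfolding young_diagram_def by blast+

lemma young_diagram_finite: "young_diagram L \<Longrightarrow> finite L"
  by (simp add: young_diagram_def)

lemma finite_row: "finite L \<Longrightarrow> finite {j. (i, j) \<in> L}"
  by (rule finite_subset[of _ "snd ` L"]) force+

lemma finite_col: "finite L \<Longrightarrow> finite {i. (i, j) \<in> L}"
  by (rule finite_subset[of _ "fst ` L"]) force+

lemma young_diagram_mem_row:
  assumes L: "young_diagram L"
  shows "(i, j) \<in> L \<longleftrightarrow> 1 \<le> i \<and> 1 \<le> j \<and> j \<le> row_length L i"
proof -
  from finite_row[OF young_diagram_finite[OF L]] have "{j. (i, j) \<in> L} = {1..row_length L i}"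
    unfolding row_length_def
  proof (rule initial_segment_eq)
    show "1 \<le> s" if "s \<in> {j. (i, j) \<in> L}" for s
      using young_diagram_pos[OF L] that by simp
    show "t \<in> {j. (i, j) \<in> L}" if "s \<in> {j. (i, j) \<in> L}" "1 \<le> t" "t \<le> s" for s t
      using young_diagram_downward[OF L, of i s i t] young_diagram_pos[OF L, of i s] that by simp
  qed
  then have "j \<in> {j. (i, j) \<in> L} \<longleftrightarrow> j \<in> {1..row_length L i}" by (rule arg_cong)
  then show ?thesis using young_diagram_pos(1)[OF L, of i j] by (simp only: mem_Collect_eq atLeastAtMost_iff) blast
qed

lemma young_diagram_mem_col:
  assumes L: "young_diagram L"
  shows "(i, j) \<in> L \<longleftrightarrow> 1 \<le> i \<and> 1 \<le> j \<and> i \<le> col_length L j"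
proof -
  from finite_col[OF young_diagram_finite[OF L]] have "{i. (i, j) \<in> L} = {1..col_length L j}"
    unfolding col_length_def
  proof (rule initial_segment_eq)
    show "1 \<le> s" if "s \<in> {i. (i, j) \<in> L}" for s
      using young_diagram_pos[OF L] that by simp
    show "t \<in> {i. (i, j) \<in> L}" if "s \<in> {i. (i, j) \<in> L}" "1 \<le> t" "t \<le> s" for s t
      using young_diagram_downward[OF L, of s j t j] young_diagram_pos[OF L, of s j] that by simp
  qed
  then have "i \<in> {i. (i, j) \<in> L} \<longleftrightarrow> i \<in> {1..col_length L j}" by (rule arg_cong)
  then show ?thesis using young_diagram_pos(2)[OF L, of i j] by (simp only: mem_Collect_eq atLeastAtMost_iff) blast
qed

lemma row_col_length:
  assumes "young_diagram L" "1 \<le> i" "1 \<le> j"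
  shows "j \<le> row_length L i \<longleftrightarrow> i \<le> col_length L j"
  using young_diagram_mem_row[OF assms(1), of i j] young_diagram_mem_col[OF assms(1), of i j] assms
  by simp

lemma row_length_antimono:
  assumes L: "young_diagram L" and "1 \<le> i" "i \<le> i'"
  shows "row_length L i' \<le> row_length L i"
proof (cases "row_length L i' = 0")
  case False
  then have "(i', row_length L i') \<in> L"
    using young_diagram_mem_row[OF L, of i' "row_length L i'"] assms by simp
  then have "(i, row_length L i') \<in> L"
    using young_diagram_downward[OF L, of i' "row_length L i'" i "row_length L i'"] assms False
    by simp
  then show ?thesis
    using young_diagram_mem_row[OF L, of i "row_length L i'"] by simp
qed simp

lemma row_length_pos_iff:
  assumes "young_diagram L" "1 \<le> i"
  shows "0 < row_length L i \<longleftrightarrow> i \<le> col_length L 1"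
  using row_col_length[OF assms, of 1] by simp linarith

lemma sum_row_length:
  assumes L: "young_diagram L"
  shows "(\<Sum>i=1..col_length L 1. row_length L i) = card L"
proof -
  have "L = (SIGMA i:{1..col_length L 1}. {1..row_length L i})"
  proof (intro set_eqI)
    fix b :: box
    obtain i j where b: "b = (i, j)" by (cases b)
    show "b \<in> L \<longleftrightarrow> b \<in> (SIGMA i:{1..col_length L 1}. {1..row_length L i})"
      using young_diagram_mem_row[OF L, of i j] row_length_pos_iff[OF L, of i] by (auto simp: b)
  qed
  then have "card L = card (SIGMA i:{1..col_length L 1}. {1..row_length L i})" by simp
  then show ?thesis by simp
qed

text \<open>These rows index both kinds of corners: such a row \<open>r\<close> ends in a removable
  box, and row \<open>r + 1\<close> can then be extended. The one further addable box lies in row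
  1.\<close>

definition corner_rows :: "box set \<Rightarrow> nat set" where
  "corner_rows L = {i \<in> {1..col_length L 1}. row_length L (i + 1) < row_length L i}"

lemma finite_corner_rows: "finite (corner_rows L)"
  by (simp add: corner_rows_def)

lemma corner_rows_iff:
  assumes "young_diagram L"
  shows "i \<in> corner_rows L \<longleftrightarrow> 1 \<le> i \<and> row_length L (i + 1) < row_length L i"
  using row_length_pos_iff[OF assms, of i] by (auto simp: corner_rows_def)

lemma removable_iff:
  assumes L: "young_diagram L"
  shows "(r, c) \<in> removable L \<longleftrightarrow> r \<in> corner_rows L \<and> c = row_length L r"
proof
  assume "(r, c) \<in> removable L"
  then have rc: "(r, c) \<in> L" and M: "young_diagram (L - {(r, c)})"
    by (auto simp: removable_def)
  have le: "1 \<le> r" "1 \<le> c" "c \<le> row_length L r"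
    using rc young_diagram_mem_row[OF L, of r c] by auto
  have "(r, c + 1) \<notin> L" "(r + 1, c) \<notin> L"
    using young_diagram_downward[OF M, of r "c + 1" r c]
      young_diagram_downward[OF M, of "r + 1" c r c] le by auto
  then show "r \<in> corner_rows L \<and> c = row_length L r"
    using le young_diagram_mem_row[OF L, of r "c + 1"] young_diagram_mem_row[OF L, of "r + 1" c]
    by (simp add: corner_rows_iff[OF L])
next
  assume r: "r \<in> corner_rows L \<and> c = row_length L r"
  then have r1: "1 \<le> r" and lt: "row_length L (r + 1) < c"
    using corner_rows_iff[OF L] by auto
  have rc: "(r, c) \<in> L" using r r1 lt young_diagram_mem_row[OF L, of r c] by simp
  have "(i', j') \<in> L - {(r, c)}"
    if ij: "(i, j) \<in> L - {(r, c)}" "1 \<le> i'" "i' \<le> i" "1 \<le> j'" "j' \<le> j" for i j i' j'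
  proof -
    have "(i', j') \<in> L" using young_diagram_downward[OF L] ij by blast
    moreover have "(i', j') \<noteq> (r, c)"
    proof
      assume eq: "(i', j') = (r, c)"
      \<comment> \<open>A box weakly south-east of \<open>(r, c)\<close> either lies in row
        \<open>r\<close>, and is then \<open>(r, c)\<close> itself, or lies in a lower row, which is
        too short.\<close>
      have "j \<le> row_length L i" using young_diagram_mem_row[OF L, of i j] ij by simp
      then show False
        using eq ij r lt row_length_antimono[OF L, of "r + 1" i] by (cases "i = r") auto
    qed
    ultimately show ?thesis by simp
  qed
  then have "young_diagram (L - {(r, c)})"
    using young_diagram_finite[OF L] young_diagram_pos[OF L] unfolding young_diagram_def
    by blast
  with rc show "(r, c) \<in> removable L" by (simp add: removable_def)
qed

lemma removable_eq:
  assumes "young_diagram L"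
  shows "removable L = (\<lambda>r. (r, row_length L r)) ` corner_rows L"
  using removable_iff[OF assms] by auto

lemma addable_iff:
  assumes L: "young_diagram L"
  shows "(i, j) \<in> addable L \<longleftrightarrow>
    i \<in> insert 1 (Suc ` corner_rows L) \<and> j = row_length L i + 1"
proof
  assume "(i, j) \<in> addable L"
  then have nij: "(i, j) \<notin> L" and M: "young_diagram (insert (i, j) L)"
    by (auto simp: addable_def)
  have pos: "1 \<le> i" "1 \<le> j" using young_diagram_pos[OF M, of i j] by auto
  have gt: "row_length L i < j" using nij pos young_diagram_mem_row[OF L, of i j] by simp
  have j: "j = row_length L i + 1"
  proof (rule ccontr)
    assume "j \<noteq> row_length L i + 1"
    then have "(i, row_length L i + 1) \<in> L"
      using young_diagram_downward[OF M, of i j i "row_length L i + 1"] pos gt by simp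
    then show False using young_diagram_mem_row[OF L, of i "row_length L i + 1"] by simp
  qed
  have "i - 1 \<in> corner_rows L" if "i \<noteq> 1"
  proof -
    have "1 \<le> i - 1" "i - 1 \<noteq> i" using pos that by linarith+
    then have "(i - 1, j) \<in> L"
      using young_diagram_downward[OF M, of i j "i - 1" j] pos by simp
    then show ?thesis
      using young_diagram_mem_row[OF L, of "i - 1" j] j pos corner_rows_iff[OF L, of "i - 1"]
      by simp
  qed
  then have "i \<in> insert 1 (Suc ` corner_rows L)"
    using pos by (cases i) auto
  with j show "i \<in> insert 1 (Suc ` corner_rows L) \<and> j = row_length L i + 1" by blast
next
  assume a: "i \<in> insert 1 (Suc ` corner_rows L) \<and> j = row_length L i + 1"
  have i1: "1 \<le> i" using a by auto
  \<comment> \<open>A corner in row \<open>i - 1\<close> makes all higher rows reach column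
    \<open>j\<close>, so everything above the new box is present.\<close>
  have above: "row_length L i < row_length L s" if "1 \<le> s" "s < i" for s
  proof -
    have "i - 1 \<in> corner_rows L" using a that by auto
    then have "row_length L i < row_length L (i - 1)"
      using corner_rows_iff[OF L, of "i - 1"] i1 by simp
    moreover have "row_length L (i - 1) \<le> row_length L s"
      using that by (intro row_length_antimono[OF L]) auto
    ultimately show ?thesis by simp
  qed
  have nij: "(i, j) \<notin> L" using a young_diagram_mem_row[OF L, of i j] by simp
  have "(i', j') \<in> insert (i, j) L"
    if st: "(s, t) \<in> insert (i, j) L" "1 \<le> i'" "i' \<le> s" "1 \<le> j'" "j' \<le> t" for s t i' j'
  proof (cases "(s, t) = (i, j)")
    case True
    show ?thesis
    proof (cases "i' = i")
      case True
      then show ?thesis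
        using a st young_diagram_mem_row[OF L, of i' j'] \<open>(s, t) = (i, j)\<close> by auto
    next
      case False
      then show ?thesis
        using a above[of i'] st young_diagram_mem_row[OF L, of i' j'] \<open>(s, t) = (i, j)\<close> by auto
    qed
  next
    case False
    then show ?thesis using young_diagram_downward[OF L] st by blast
  qed
  moreover have "1 \<le> s \<and> 1 \<le> t" if "(s, t) \<in> insert (i, j) L" for s t
    using that a i1 young_diagram_pos[OF L, of s t] by auto
  ultimately have "young_diagram (insert (i, j) L)"
    using young_diagram_finite[OF L] unfolding young_diagram_def by blast
  with nij show "(i, j) \<in> addable L" by (simp add: addable_def)
qed

lemma addable_eq:
  assumes "young_diagram L"
  shows "addable L = (\<lambda>i. (i, row_length L i + 1)) ` insert 1 (Suc ` corner_rows L)"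
proof (intro set_eqI)
  fix b :: box
  obtain i j where b: "b = (i, j)" by (cases b)
  show "b \<in> addable L \<longleftrightarrow> b \<in> (\<lambda>i. (i, row_length L i + 1)) ` insert 1 (Suc ` corner_rows L)"
    unfolding b addable_iff[OF assms] by blast
qed

lemma adds_box_iff:
  "adds_box M L \<longleftrightarrow> young_diagram L \<and> (\<exists>b\<in>removable L. M = L - {b})"
proof
  assume "adds_box M L"
  then obtain b where L: "young_diagram M" "young_diagram L" "b \<notin> M" "L = insert b M"
    unfolding adds_box_def by blast
  then have "M = L - {b}" by simp
  moreover from this L have "b \<in> removable L" by (simp add: removable_def)
  ultimately show "young_diagram L \<and> (\<exists>b\<in>removable L. M = L - {b})"
    using L(2) by blast
next
  assume "young_diagram L \<and> (\<exists>b\<in>removable L. M = L - {b})"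
  then obtain b where "young_diagram L" "b \<in> L" "young_diagram (L - {b})" "M = L - {b}"
    unfolding removable_def by blast
  then show "adds_box M L"
    unfolding adds_box_def by blast
qed

text \<open>The \<open>\<alpha>\<close>-contents of the upper and lower end points of the right edge
  of row \<open>i\<close>. Empty rows are allowed: just below the diagram the upper content is minus
  the number of rows.\<close>

definition upper_content :: "real \<Rightarrow> box set \<Rightarrow> nat \<Rightarrow> real" where
  "upper_content \<alpha> L i = \<alpha> * real (row_length L i) - (real i - 1)"

definition lower_content :: "real \<Rightarrow> box set \<Rightarrow> nat \<Rightarrow> real" where
  "lower_content \<alpha> L i = \<alpha> * real (row_length L i) - real i"

lemma upper_content_eq: "upper_content \<alpha> L i = lower_content \<alpha> L i + 1"
  by (simp add: upper_content_def lower_content_def)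

lemma se_content_corner: "se_content \<alpha> (i, row_length L i) = lower_content \<alpha> L i"
  by (simp add: se_content_def lower_content_def)

lemma nw_content_end: "nw_content \<alpha> (i, row_length L i + 1) = upper_content \<alpha> L i"
  by (simp add: nw_content_def upper_content_def)

lemma lower_content_less:
  assumes "\<alpha> > 0" "young_diagram L" "1 \<le> i" "i < i'"
  shows "lower_content \<alpha> L i' < lower_content \<alpha> L i"
proof -
  have "\<alpha> * real (row_length L i') \<le> \<alpha> * real (row_length L i)"
    using row_length_antimono[OF assms(2,3), of i'] assms by simp
  then show ?thesis using assms(4) by (simp add: lower_content_def)
qed

lemma upper_content_less:
  assumes "\<alpha> > 0" "young_diagram L" "1 \<le> i" "i < i'"
  shows "upper_content \<alpha> L i' < upper_content \<alpha> L i"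
  using lower_content_less[OF assms] by (simp add: upper_content_eq)

lemma upper_content_Suc_corner:
  assumes "\<alpha> > 0" "young_diagram L" "i \<in> corner_rows L"
  shows "upper_content \<alpha> L (i + 1) < lower_content \<alpha> L i"
  using assms(1,3) corner_rows_iff[OF assms(2), of i]
  by (simp add: upper_content_def lower_content_def)

text \<open>The right edges of two equally long consecutive rows share an end point. This is what
  removes non-corner rows from the products.\<close>

lemma upper_content_Suc_not_corner:
  assumes "young_diagram L" "1 \<le> i" "i \<notin> corner_rows L"
  shows "upper_content \<alpha> L (i + 1) = lower_content \<alpha> L i"
proof -
  have "row_length L (i + 1) = row_length L i"
    using assms corner_rows_iff[OF assms(1), of i] row_length_antimono[OF assms(1,2), of "i + 1"]
    by simp
  then show ?thesis by (simp add: upper_content_def lower_content_def)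
qed

lemma inj_on_lower_content:
  assumes "\<alpha> > 0" "young_diagram L" "I \<subseteq> {1..}"
  shows "inj_on (lower_content \<alpha> L) I"
proof (rule linorder_inj_onI')
  fix i i' assume "i \<in> I" "i' \<in> I" "i < i'"
  then show "lower_content \<alpha> L i \<noteq> lower_content \<alpha> L i'"
    using lower_content_less[OF assms(1,2), of i i'] assms(3) by auto
qed

lemma inj_on_upper_content:
  assumes "\<alpha> > 0" "young_diagram L" "I \<subseteq> {1..}"
  shows "inj_on (upper_content \<alpha> L) I"
  using inj_on_lower_content[OF assms] by (simp add: inj_on_def upper_content_eq)

subsection \<open>Hook products\<close>

lemma row_length_remove:
  assumes "young_diagram L" "(r, c) \<in> L"
  shows "real (row_length (L - {(r, c)}) i) = real (row_length L i) - (if i = r then 1 else 0)"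
proof (cases "i = r")
  case True
  have "{j. (i, j) \<in> L - {(r, c)}} = {j. (i, j) \<in> L} - {c}"
    using True by blast
  then have "row_length (L - {(r, c)}) i = row_length L i - 1"
    using True assms(2) by (simp only: row_length_def) (simp add: card_Diff_singleton)
  moreover have "{j. (i, j) \<in> L} \<noteq> {}" using True assms(2) by blast
  then have "0 < row_length L i"
    using finite_row[OF young_diagram_finite[OF assms(1)]] by (simp add: row_length_def card_gt_0_iff)
  ultimately show ?thesis using True by simp
next
  case False
  then show ?thesis by (simp add: row_length_def)
qed

lemma col_length_remove:
  assumes "young_diagram L" "(r, c) \<in> L"
  shows "real (col_length (L - {(r, c)}) j) = real (col_length L j) - (if j = c then 1 else 0)"
proof (cases "j = c")
  case True
  have "{i. (i, j) \<in> L - {(r, c)}} = {i. (i, j) \<in> L} - {r}"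
    using True by blast
  then have "col_length (L - {(r, c)}) j = col_length L j - 1"
    using True assms(2) by (simp only: col_length_def) (simp add: card_Diff_singleton)
  moreover have "{i. (i, j) \<in> L} \<noteq> {}" using True assms(2) by blast
  then have "0 < col_length L j"
    using finite_col[OF young_diagram_finite[OF assms(1)]] by (simp add: col_length_def card_gt_0_iff)
  ultimately show ?thesis using True by simp
next
  case False
  then show ?thesis by (simp add: col_length_def)
qed

lemma col_length_corner:
  assumes L: "young_diagram L" and r: "r \<in> corner_rows L"
  shows "col_length L (row_length L r) = r"
proof -
  have "1 \<le> r" "1 \<le> row_length L r" "row_length L (r + 1) < row_length L r"
    using r corner_rows_iff[OF L, of r] by auto
  then show ?thesis
    using row_col_length[OF L, of r "row_length L r"]
      row_col_length[OF L, of "r + 1" "row_length L r"] by simp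
qed

lemma arm_nonneg: "young_diagram L \<Longrightarrow> b \<in> L \<Longrightarrow> 0 \<le> arm L b"
  using young_diagram_mem_row[of L "fst b" "snd b"] by (simp add: arm_def)

lemma leg_nonneg: "young_diagram L \<Longrightarrow> b \<in> L \<Longrightarrow> 0 \<le> leg L b"
  using young_diagram_mem_col[of L "fst b" "snd b"] by (simp add: leg_def)

definition upper_hook :: "real \<Rightarrow> box set \<Rightarrow> box \<Rightarrow> real" where
  "upper_hook \<alpha> L b = (arm L b + 1) * \<alpha> + leg L b"

definition hook_prod :: "real \<Rightarrow> box set \<Rightarrow> real" where
  "hook_prod \<alpha> L = (\<Prod>b\<in>L. upper_hook \<alpha> L b)"

lemma upper_hook_pos:
  assumes "\<alpha> > 0" "young_diagram L" "b \<in> L"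
  shows "upper_hook \<alpha> L b > 0"
proof -
  have "(arm L b + 1) * \<alpha> > 0" using arm_nonneg[OF assms(2,3)] assms(1) by simp
  then show ?thesis using leg_nonneg[OF assms(2,3)] by (simp add: upper_hook_def)
qed

lemma hook_prod_pos:
  assumes "\<alpha> > 0" "young_diagram L"
  shows "hook_prod \<alpha> L > 0"
  unfolding hook_prod_def using upper_hook_pos[OF assms] by (rule prod_pos)

text \<open>Erasing \<open>(r, c)\<close> changes hooks only in its row and column. In the column,
  the hook ratios cancel against \<open>kappa\<close> and leave differences of contents of rows; in
  the row, column lengths remain. The last factor \<open>\<alpha>\<close> is the upper hook of the
  erased box.\<close>

lemma kappa_hook_prod_arm_leg:
  assumes \<alpha>: "\<alpha> > 0" and L: "young_diagram L" and r: "r \<in> corner_rows L"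
  defines "c \<equiv> row_length L r"
  defines "M \<equiv> L - {(r, c)}"
  shows "kappa \<alpha> M L * hook_prod \<alpha> L / hook_prod \<alpha> M =
    (\<Prod>i=1..<r. (upper_content \<alpha> L i - lower_content \<alpha> L r) /
       (lower_content \<alpha> L i - lower_content \<alpha> L r)) *
    ((\<Prod>j=1..<c. ((real c - real j + 1) * \<alpha> + real (col_length L j) - real r) /
       ((real c - real j) * \<alpha> + real (col_length L j) - real r)) * \<alpha>)"
proof -
  have rem: "(r, c) \<in> removable L"
    using removable_iff[OF L] r c_def by simp
  then have rc: "(r, c) \<in> L" and M: "young_diagram M"
    by (auto simp: removable_def M_def)
  have r1: "1 \<le> r" and c1: "1 \<le> c" using young_diagram_pos[OF L rc] by auto
  have col: "col_length L c = r" using col_length_corner[OF L r] c_def by simp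
  have Lins: "L = insert (r, c) M" and rcM: "(r, c) \<notin> M" using rc M_def by auto
  have finM: "finite M" using young_diagram_finite[OF M] .
  have armM: "arm M b = arm L b - (if fst b = r then 1 else 0)" for b
    using row_length_remove[OF L rc] by (simp add: arm_def M_def)
  have legM: "leg M b = leg L b - (if snd b = c then 1 else 0)" for b
    using col_length_remove[OF L rc] by (simp add: leg_def M_def)
  define ratio where "ratio b = upper_hook \<alpha> L b / upper_hook \<alpha> M b" for b
  define C where "C = {b \<in> M. snd b = c}"
  define R where "R = {b \<in> M. fst b = r}"
  have C_eq: "C = (\<lambda>i. (i, c)) ` {1..<r}"
  proof (intro set_eqI)
    fix b :: box
    obtain i j where b: "b = (i, j)" by (cases b)
    show "b \<in> C \<longleftrightarrow> b \<in> (\<lambda>i. (i, c)) ` {1..<r}"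
      using young_diagram_mem_col[OF L, of i j] c1 col by (auto simp: b C_def M_def)
  qed
  have R_eq: "R = (\<lambda>j. (r, j)) ` {1..<c}"
  proof (intro set_eqI)
    fix b :: box
    obtain i j where b: "b = (i, j)" by (cases b)
    show "b \<in> R \<longleftrightarrow> b \<in> (\<lambda>j. (r, j)) ` {1..<c}"
      using young_diagram_mem_row[OF L, of i j] r1 by (auto simp: b R_def M_def c_def)
  qed
  have "upper_hook \<alpha> L (r, c) = \<alpha>"
    by (simp add: upper_hook_def arm_def leg_def col c_def[symmetric])
  then have "hook_prod \<alpha> L = \<alpha> * (\<Prod>b\<in>M. upper_hook \<alpha> L b)"
    using rcM finM by (simp add: hook_prod_def Lins)
  then have "hook_prod \<alpha> L / hook_prod \<alpha> M = \<alpha> * (\<Prod>b\<in>M. ratio b)"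
    by (simp add: ratio_def hook_prod_def prod_dividef)
  also have "(\<Prod>b\<in>M. ratio b) = (\<Prod>b\<in>C \<union> R. ratio b)"
  proof (rule prod.mono_neutral_right[OF finM])
    show "\<forall>b\<in>M - (C \<union> R). ratio b = 1"
    proof
      fix b assume b: "b \<in> M - (C \<union> R)"
      then have "upper_hook \<alpha> L b = upper_hook \<alpha> M b"
        by (simp add: upper_hook_def armM legM C_def R_def)
      then show "ratio b = 1" using upper_hook_pos[OF \<alpha> M, of b] b by (simp add: ratio_def)
    qed
  qed (auto simp: C_def R_def)
  also have "\<dots> = (\<Prod>b\<in>C. ratio b) * (\<Prod>b\<in>R. ratio b)"
  proof (rule prod.union_disjoint)
    show "C \<inter> R = {}"
    proof (rule equals0I)
      fix b assume "b \<in> C \<inter> R"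
      then have "b = (r, c)" "b \<in> M" by (auto simp: C_def R_def prod_eq_iff)
      then show False using rcM by simp
    qed
  qed (auto simp: C_def R_def finM)
  finally have H: "hook_prod \<alpha> L / hook_prod \<alpha> M =
      \<alpha> * ((\<Prod>b\<in>C. ratio b) * (\<Prod>b\<in>R. ratio b))" .
  define kap where "kap b = ((arm M b * \<alpha> + leg M b + 2) * ((arm M b + 1) * \<alpha> + leg M b)) /
        (((arm M b + 1) * \<alpha> + leg M b + 1) * (arm M b * \<alpha> + leg M b + 1))" for b
  have "L - M = {(r, c)}" using rc M_def by auto
  then have K: "kappa \<alpha> M L = (\<Prod>b\<in>C. kap b)"
    by (simp add: kappa_def C_def kap_def)
  have colf: "kap (i, c) * ratio (i, c) =
      (upper_content \<alpha> L i - lower_content \<alpha> L r) / (lower_content \<alpha> L i - lower_content \<alpha> L r)"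
    if i: "i \<in> {1..<r}" for i
  proof -
    \<comment> \<open>\<open>a\<close> and \<open>l\<close> are arm and leg in \<open>L\<close>. In
      \<open>M\<close> the arm is the same and the leg is \<open>l - 1\<close>, so the upper hooks
      cancel and only the factors with \<open>a * \<alpha>\<close> survive.\<close>
    define a where "a = real (row_length L i) - real c"
    define l where "l = real r - real i"
    have "(i, c) \<in> L" using i c1 col young_diagram_mem_col[OF L, of i c] by simp
    then have "a \<ge> 0" using arm_nonneg[OF L, of "(i, c)"] by (simp add: arm_def a_def)
    then have a: "a * \<alpha> \<ge> 0" using \<alpha> by simp
    have l: "l \<ge> 1" using i by (simp add: l_def)
    have "arm L (i, c) = a" "leg L (i, c) = l"
      by (simp_all add: arm_def leg_def a_def l_def col)
    moreover from this have "arm M (i, c) = a" "leg M (i, c) = l - 1"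
      using i by (simp_all add: armM legM)
    ultimately have "kap (i, c) * ratio (i, c) =
       ((a * \<alpha> + (l - 1) + 2) * ((a + 1) * \<alpha> + (l - 1))) /
       (((a + 1) * \<alpha> + (l - 1) + 1) * (a * \<alpha> + (l - 1) + 1)) *
       (((a + 1) * \<alpha> + l) / ((a + 1) * \<alpha> + (l - 1)))"
      by (simp only: kap_def ratio_def upper_hook_def)
    also have "\<dots> = (a * \<alpha> + l + 1) / (a * \<alpha> + l)"
    proof -
      have "(a + 1) * \<alpha> + (l - 1) \<noteq> 0" "(a + 1) * \<alpha> + l \<noteq> 0"
        using a l \<alpha> by (auto simp: distrib_right)
      moreover have "a * \<alpha> + (l - 1) + 2 = a * \<alpha> + l + 1"
        "(a + 1) * \<alpha> + (l - 1) + 1 = (a + 1) * \<alpha> + l" "a * \<alpha> + (l - 1) + 1 = a * \<alpha> + l"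
        by simp_all
      ultimately show ?thesis
        by (simp only: times_divide_times_eq nonzero_mult_divide_mult_cancel_left mult.commute
            mult.left_commute mult.assoc mult_eq_0_iff) simp
    qed
    also have "a * \<alpha> + l + 1 = upper_content \<alpha> L i - lower_content \<alpha> L r"
      by (simp add: a_def l_def upper_content_def lower_content_def c_def algebra_simps)
    also have "a * \<alpha> + l = lower_content \<alpha> L i - lower_content \<alpha> L r"
      by (simp add: a_def l_def lower_content_def c_def algebra_simps)
    finally show ?thesis .
  qed
  have rowf: "ratio (r, j) = ((real c - real j + 1) * \<alpha> + real (col_length L j) - real r) /
       ((real c - real j) * \<alpha> + real (col_length L j) - real r)"
    if j: "j \<in> {1..<c}" for j
  proof -
    have "arm L (r, j) = real c - real j" "leg L (r, j) = real (col_length L j) - real r"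
      by (simp_all add: arm_def leg_def c_def)
    moreover from this have "arm M (r, j) = real c - real j - 1"
      "leg M (r, j) = real (col_length L j) - real r"
      using j by (simp_all add: armM legM)
    ultimately show ?thesis by (simp add: ratio_def upper_hook_def add_diff_eq)
  qed
  have "kappa \<alpha> M L * hook_prod \<alpha> L / hook_prod \<alpha> M =
      (\<Prod>b\<in>C. kap b * ratio b) * ((\<Prod>b\<in>R. ratio b) * \<alpha>)"
    unfolding times_divide_eq_right[symmetric] H K by (simp add: prod.distrib)
  also have "(\<Prod>b\<in>C. kap b * ratio b) = (\<Prod>i=1..<r. kap (i, c) * ratio (i, c))"
    unfolding C_eq by (subst prod.reindex) (auto simp: inj_on_def)
  also have "(\<Prod>b\<in>R. ratio b) = (\<Prod>j=1..<c. ratio (r, j))"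
    unfolding R_eq by (subst prod.reindex) (auto simp: inj_on_def)
  finally show ?thesis
    by (simp add: colf rowf)
qed

text \<open>The rows below row \<open>r\<close> form a diagram left of column \<open>c\<close>.
  Applying \<open>rows_eq_columns_prod\<close> to it trades the product over columns for one over
  the rows \<open>r + 1\<close> to \<open>N\<close>.\<close>

lemma kappa_hook_prod:
  assumes \<alpha>: "\<alpha> > 0" and L: "young_diagram L" and r: "r \<in> corner_rows L"
  defines "N \<equiv> col_length L 1"
  shows "kappa \<alpha> (L - {(r, row_length L r)}) L * hook_prod \<alpha> L /
      hook_prod \<alpha> (L - {(r, row_length L r)}) =
    (lower_content \<alpha> L r + real N) *
    (\<Prod>i\<in>{1..N} - {r}. (lower_content \<alpha> L r - upper_content \<alpha> L i) /
       (lower_content \<alpha> L r - lower_content \<alpha> L i))"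
proof -
  let ?u = "upper_content \<alpha> L" and ?v = "lower_content \<alpha> L"
  define c where "c = row_length L r"
  have r1: "1 \<le> r" "r \<le> N" and lt: "row_length L (r + 1) < c"
    using r by (auto simp: corner_rows_def c_def N_def)
  \<comment> \<open>\<open>G s t\<close> is the content of the south-east corner of
    \<open>(r, c)\<close> minus that of the point \<open>t\<close> rows lower at abscissa
    \<open>s\<close>.\<close>
  define G where "G s t = (real c - real s) * \<alpha> + real t" for s t
  have row_eq: "(\<Prod>i=1..N - r. G (row_length L (r + i)) (i - 1) / G (row_length L (r + i)) i)
        * G 0 (N - r) =
      (\<Prod>j=1..c - 1. G (j - 1) (col_length L j - r) / G j (col_length L j - r)) * G (c - 1) 0"
  proof (rule rows_eq_columns_prod)
    show "G s t \<noteq> 0" if "s \<le> c - 1" "t \<le> N - r" for s t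
    proof -
      have "(real c - real s) * \<alpha> > 0" using that lt \<alpha> by simp
      then show ?thesis by (simp add: G_def)
    qed
    show "row_length L (r + i) \<le> c - 1" if "i \<in> {1..N - r}" for i
      using row_length_antimono[OF L, of "r + 1" "r + i"] that lt by simp
    show "col_length L j - r \<le> N - r" if "j \<in> {1..c - 1}" for j
    proof (cases "col_length L j = 0")
      case False
      then have "j \<le> row_length L (col_length L j)"
        using row_col_length[OF L, of "col_length L j" j] that by simp
      then show ?thesis
        using row_length_pos_iff[OF L, of "col_length L j"] False that by (simp add: N_def)
    qed simp
    show "j \<le> row_length L (r + i) \<longleftrightarrow> i \<le> col_length L j - r"
      if "i \<in> {1..N - r}" "j \<in> {1..c - 1}" for i j
      using row_col_length[OF L, of "r + i" j] that by auto
  qed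
  have cols: "(\<Prod>j=1..<c. ((real c - real j + 1) * \<alpha> + real (col_length L j) - real r) /
       ((real c - real j) * \<alpha> + real (col_length L j) - real r)) * \<alpha> =
      (\<Prod>j=1..c - 1. G (j - 1) (col_length L j - r) / G j (col_length L j - r)) * G (c - 1) 0"
  proof -
    have "((real c - real j + 1) * \<alpha> + real (col_length L j) - real r) /
       ((real c - real j) * \<alpha> + real (col_length L j) - real r) =
       G (j - 1) (col_length L j - r) / G j (col_length L j - r)" if "j \<in> {1..c - 1}" for j
    proof -
      have "r \<le> col_length L j"
        using row_col_length[OF L, of r j] that r1 by (auto simp: c_def)
      then show ?thesis
        using that by (simp add: G_def of_nat_diff algebra_simps)
    qed
    moreover have "G (c - 1) 0 = \<alpha>" using lt by (simp add: G_def of_nat_diff)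
    moreover have "{1..<c} = {1..c - 1}" using lt by auto
    ultimately show ?thesis by (simp only: cong: prod.cong)
  qed
  have "(\<Prod>i=1..N - r. G (row_length L (r + i)) (i - 1) / G (row_length L (r + i)) i) =
      (\<Prod>i=1..N - r. (?v r - ?u (i + r)) / (?v r - ?v (i + r)))"
    by (intro prod.cong refl arg_cong2[of _ _ _ _ "(/)"])
      (auto simp: G_def upper_content_def lower_content_def c_def of_nat_diff algebra_simps)
  also have "\<dots> = (\<Prod>i=r + 1..N. (?v r - ?u i) / (?v r - ?v i))"
    using prod.shift_bounds_cl_nat_ivl[of "\<lambda>i. (?v r - ?u i) / (?v r - ?v i)" 1 r "N - r"] r1
    by (simp add: add.commute)
  finally have rows: "(\<Prod>i=1..N - r. G (row_length L (r + i)) (i - 1) / G (row_length L (r + i)) i) =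
      (\<Prod>i=r + 1..N. (?v r - ?u i) / (?v r - ?v i))" .
  \<comment> \<open>The bottom left point of the diagram gives the factor that belongs to no
    row.\<close>
  have G0: "G 0 (N - r) = ?v r + real N"
    using r1 by (simp add: G_def lower_content_def c_def of_nat_diff)
  have "(\<Prod>i\<in>{1..N} - {r}. (?v r - ?u i) / (?v r - ?v i)) =
      (\<Prod>i\<in>{1..<r} \<union> {r + 1..N}. (?v r - ?u i) / (?v r - ?v i))"
    using r1 by (intro prod.cong) auto
  also have "\<dots> = (\<Prod>i=1..<r. (?v r - ?u i) / (?v r - ?v i)) *
      (\<Prod>i=r + 1..N. (?v r - ?u i) / (?v r - ?v i))"
    by (rule prod.union_disjoint) auto
  also have "(\<Prod>i=1..<r. (?v r - ?u i) / (?v r - ?v i)) =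
      (\<Prod>i=1..<r. (?u i - ?v r) / (?v i - ?v r))"
    by (intro prod.cong refl) (metis minus_diff_eq minus_divide_divide)
  finally show ?thesis
    unfolding kappa_hook_prod_arm_leg[OF \<alpha> L r] cols[unfolded c_def] row_eq[unfolded c_def, symmetric]
      rows[unfolded c_def] G0 by (simp add: mult_ac)
qed

text \<open>Once extended by zero to all rows, the sum is minus a divided difference at the lower
  contents, of the polynomial with roots \<open>- real N\<close> and the upper contents.\<close>

lemma sum_kappa_hook_prod:
  assumes \<alpha>: "\<alpha> > 0" and L: "young_diagram L"
  shows "(\<Sum>r\<in>corner_rows L. kappa \<alpha> (L - {(r, row_length L r)}) L * hook_prod \<alpha> L /
      hook_prod \<alpha> (L - {(r, row_length L r)})) = \<alpha> * real (card L)"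
proof -
  let ?u = "upper_content \<alpha> L" and ?v = "lower_content \<alpha> L"
  define N where "N = col_length L 1"
  define w where "w r = (?v r + real N) * (\<Prod>i\<in>{1..N} - {r}. (?v r - ?u i) / (?v r - ?v i))" for r
  have u: "?u i = ?v i + 1" for i by (rule upper_content_eq)
  have "(\<Sum>r\<in>corner_rows L. kappa \<alpha> (L - {(r, row_length L r)}) L * hook_prod \<alpha> L /
      hook_prod \<alpha> (L - {(r, row_length L r)})) = (\<Sum>r\<in>corner_rows L. w r)"
    using kappa_hook_prod[OF \<alpha> L] by (simp add: w_def N_def)
  also have "\<dots> = (\<Sum>r=1..N. w r)"
  proof (rule sum.mono_neutral_left)
    show "\<forall>r\<in>{1..N} - corner_rows L. w r = 0"
    proof
      fix r assume r: "r \<in> {1..N} - corner_rows L"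
      then have eq: "?u (r + 1) = ?v r" using upper_content_Suc_not_corner[OF L, of r] by simp
      \<comment> \<open>Row \<open>r + 1\<close> is as long as row \<open>r\<close>, hence nonempty,
        so the vanishing factor does occur in the product.\<close>
      have "row_length L (r + 1) > 0"
        using r row_length_pos_iff[OF L, of r] corner_rows_iff[OF L, of r] by (auto simp: N_def)
      then have "r + 1 \<in> {1..N} - {r}"
        using row_length_pos_iff[OF L, of "r + 1"] by (simp add: N_def)
      then have "(\<Prod>i\<in>{1..N} - {r}. (?v r - ?u i) / (?v r - ?v i)) = 0"
        using eq by (intro prod_zero bexI[of _ "r + 1"]) auto
      then show "w r = 0" by (simp add: w_def)
    qed
  qed (auto simp: corner_rows_def N_def)
  also have "\<dots> = - divdiff ?v {1..N} (\<lambda>z. (z - (- real N)) * (\<Prod>i=1..N. z - ?u i))"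
    unfolding divdiff_def sum_negf[symmetric]
  proof (rule sum.cong[OF refl])
    fix r assume r: "r \<in> {1..N}"
    \<comment> \<open>The factor \<open>i = r\<close> missing from \<open>w r\<close> equals -1;
      this is the source of the sign.\<close>
    have "(\<Prod>i=1..N. ?v r - ?u i) = - (\<Prod>i\<in>{1..N} - {r}. ?v r - ?u i)"
      using prod.remove[OF _ r, of "\<lambda>i. ?v r - ?u i"] by (simp add: u)
    then show "w r = - ((?v r - (- real N)) * (\<Prod>i=1..N. ?v r - ?u i) /
        (\<Prod>j\<in>{1..N} - {r}. ?v r - ?v j))"
      by (simp add: w_def prod_dividef)
  qed
  also have "\<dots> = \<alpha> * real (card L)"
  proof -
    have inj: "inj_on ?v {1..N}" using inj_on_lower_content[OF \<alpha> L] by auto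
    have "(\<Sum>i=1..N. (?v i)\<^sup>2 - (?u i)\<^sup>2) = (\<Sum>i=1..N. - 2 * \<alpha> * real (row_length L i) + (2 * real i - 1))"
      by (intro sum.cong refl) (simp add: u lower_content_def power2_eq_square algebra_simps)
    also have "\<dots> = - 2 * \<alpha> * real (card L) + (\<Sum>i=1..N. 2 * real i - 1)"
      unfolding sum_row_length[OF L, symmetric] N_def of_nat_sum sum_distrib_left sum.distrib by simp
    also have "(\<Sum>i=1..N. 2 * real i - 1) = (real N)\<^sup>2"
      by (induction N) (auto simp: power2_eq_square algebra_simps)
    \<comment> \<open>In \<open>divdiff_prod_linear\<close> the squared bracket vanishes because the
      differences \<open>?v i - ?u i\<close> sum to \<open>- real N\<close>, and the two terms
      \<open>(real N)\<^sup>2\<close> cancel.\<close>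
    finally have "2 * divdiff ?v {1..N} (\<lambda>z. (z - (- real N)) * (\<Prod>i=1..N. z - ?u i)) =
        - 2 * \<alpha> * real (card L)"
      using divdiff_prod_linear[OF _ inj, of "- real N" ?u] by (simp add: u)
    then show ?thesis by simp
  qed
  finally show ?thesis .
qed

text \<open>An \<open>\<alpha>\<close>-analogue of the hook length formula. In the induction step
  the recursion becomes a common factor times the sum just evaluated, which contributes
  \<open>\<alpha> * real (card L)\<close>.\<close>

lemma dim_alpha_hook_prod:
  assumes \<alpha>: "\<alpha> > 0" and "young_diagram L"
  shows "dim_alpha \<alpha> L = fact (card L) * \<alpha> ^ card L / hook_prod \<alpha> L"
  using assms(2)
proof (induction "card L" arbitrary: L)
  case 0
  then have "L = {}" using young_diagram_finite by fastforce
  then show ?case by (simp add: dim_alpha.simps hook_prod_def)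
next
  case (Suc n)
  note L = \<open>young_diagram L\<close>
  let ?M = "\<lambda>r. L - {(r, row_length L r)}"
  have "L \<noteq> {}" using Suc(2) by auto
  have IH: "dim_alpha \<alpha> (?M r) = fact n * \<alpha> ^ n / hook_prod \<alpha> (?M r)" if r: "r \<in> corner_rows L" for r
  proof -
    have "(r, row_length L r) \<in> removable L" using removable_iff[OF L] r by simp
    then have "(r, row_length L r) \<in> L" "young_diagram (?M r)" by (auto simp: removable_def)
    moreover from this have "card (?M r) = n" using Suc(2) by simp
    ultimately show ?thesis using Suc(1)[of "?M r"] by simp
  qed
  have "{M. adds_box M L} = ?M ` corner_rows L"
    using L by (auto simp: adds_box_iff removable_eq)
  moreover have "inj_on ?M (corner_rows L)"
  proof (rule inj_onI)
    fix r s assume rs: "r \<in> corner_rows L" "s \<in> corner_rows L" "?M r = ?M s"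
    have "(r, row_length L r) \<in> L" using removable_iff[OF L] rs(1) by (auto simp: removable_def)
    with rs(3) show "r = s" by blast
  qed
  ultimately have "dim_alpha \<alpha> L = (\<Sum>r\<in>corner_rows L. kappa \<alpha> (?M r) L * dim_alpha \<alpha> (?M r))"
    using \<open>L \<noteq> {}\<close> by (subst dim_alpha.simps) (simp add: sum.reindex)
  also have "\<dots> = (\<Sum>r\<in>corner_rows L. fact n * \<alpha> ^ n / hook_prod \<alpha> L *
      (kappa \<alpha> (?M r) L * hook_prod \<alpha> L / hook_prod \<alpha> (?M r)))"
    using hook_prod_pos[OF \<alpha> L] by (intro sum.cong refl) (simp add: IH)
  also have "\<dots> = fact n * \<alpha> ^ n / hook_prod \<alpha> L * (\<alpha> * real (card L))"
    unfolding sum_distrib_left[symmetric] sum_kappa_hook_prod[OF \<alpha> L] ..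
  finally show ?case unfolding Suc(2)[symmetric] by (simp add: algebra_simps)
qed

lemma kappa_dim_alpha_ratio:
  assumes \<alpha>: "\<alpha> > 0" and L: "young_diagram L" and r: "r \<in> corner_rows L"
  defines "M \<equiv> L - {(r, row_length L r)}"
  shows "kappa \<alpha> M L * dim_alpha \<alpha> M / dim_alpha \<alpha> L =
    (kappa \<alpha> M L * hook_prod \<alpha> L / hook_prod \<alpha> M) / (\<alpha> * real (card L))"
proof -
  have "(r, row_length L r) \<in> removable L" using removable_iff[OF L] r by simp
  then have M: "(r, row_length L r) \<in> L" "young_diagram M" by (auto simp: removable_def M_def)
  then have "card L = Suc (card M)"
    using card_Suc_Diff1[OF young_diagram_finite[OF L]] by (simp add: M_def)
  then have "dim_alpha \<alpha> M / dim_alpha \<alpha> L =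
      hook_prod \<alpha> L / hook_prod \<alpha> M / (\<alpha> * real (card L))"
    using hook_prod_pos[OF \<alpha> L] hook_prod_pos[OF \<alpha> M(2)] \<alpha>
    by (simp add: dim_alpha_hook_prod[OF \<alpha>] L M(2))
  then show ?thesis by (simp only: times_divide_eq_right[symmetric] divide_divide_eq_left)
qed

subsection \<open>Enumerating the corners\<close>

text \<open>Both sides are the product of \<open>f\<close> over \<open>{1..m + 1}\<close>.\<close>

lemma prod_shift_first_last:
  fixes f :: "nat \<Rightarrow> 'a::comm_monoid_mult"
  shows "f 1 * (\<Prod>i=1..m. f (i + 1)) = f (m + 1) * (\<Prod>i=1..m. f i)"
proof (induction m)
  case (Suc m)
  have "f 1 * (\<Prod>i=1..Suc m. f (i + 1)) = (f 1 * (\<Prod>i=1..m. f (i + 1))) * f (Suc m + 1)"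
    by (simp add: mult_ac)
  also have "\<dots> = f (Suc m + 1) * (\<Prod>i=1..Suc m. f i)"
    unfolding Suc by (simp add: mult_ac)
  finally show ?case .
qed simp

text \<open>Rows run from bottom to top, because contents decrease as the row index grows.\<close>

definition corner_list :: "box set \<Rightarrow> nat list" where
  "corner_list L = rev (sorted_list_of_set (corner_rows L))"

lemma corner_list:
  "set (corner_list L) = corner_rows L" "distinct (corner_list L)"
  "length (corner_list L) = card (corner_rows L)"
  "sorted_wrt (>) (corner_list L)"
  by (auto simp: corner_list_def finite_corner_rows sorted_wrt_rev strict_sorted_list_of_set)

lemma sorted_list_of_set_eqI:
  assumes "sorted_wrt (<) xs" "set xs = A"
  shows "sorted_list_of_set A = xs"
  using assms by (metis List.finite_set sorted_list_of_set.idem_if_sorted_distinct strict_sorted_iff)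

lemma sorted_lower_contents:
  assumes \<alpha>: "\<alpha> > 0" and L: "young_diagram L"
  shows "sorted_list_of_set (se_content \<alpha> ` removable L) = map (lower_content \<alpha> L) (corner_list L)"
proof (rule sorted_list_of_set_eqI)
  have "sorted_wrt (\<lambda>i j. lower_content \<alpha> L i < lower_content \<alpha> L j) (corner_list L)"
  proof (rule sorted_wrt_mono_rel[OF _ corner_list(4)])
    fix i j assume "i \<in> set (corner_list L)" "j \<in> set (corner_list L)" "i > j"
    then show "lower_content \<alpha> L i < lower_content \<alpha> L j"
      using corner_rows_iff[OF L, of j] by (intro lower_content_less[OF \<alpha> L]) (auto simp: corner_list(1))
  qed
  then show "sorted_wrt (<) (map (lower_content \<alpha> L) (corner_list L))"
    by (simp add: sorted_wrt_map)
  show "set (map (lower_content \<alpha> L) (corner_list L)) = se_content \<alpha> ` removable L"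
    by (simp add: corner_list(1) removable_eq[OF L] image_image se_content_corner)
qed

text \<open>Each corner contributes the addable box in the next row; the box at the end of row 1 has
  the largest content and comes last.\<close>

lemma sorted_upper_contents:
  assumes \<alpha>: "\<alpha> > 0" and L: "young_diagram L"
  shows "sorted_list_of_set (nw_content \<alpha> ` addable L) =
    map (upper_content \<alpha> L) (map Suc (corner_list L) @ [1])"
proof (rule sorted_list_of_set_eqI)
  let ?xs = "map Suc (corner_list L) @ [1]"
  have pos: "\<forall>i\<in>set (corner_list L). 1 \<le> i"
    using corner_rows_iff[OF L] by (auto simp: corner_list(1))
  have "sorted_wrt (>) ?xs"
    using corner_list(4)[of L] pos by (auto simp: sorted_wrt_append sorted_wrt_map)
  then have "sorted_wrt (\<lambda>i j. upper_content \<alpha> L i < upper_content \<alpha> L j) ?xs"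
  proof (rule sorted_wrt_mono_rel[rotated])
    fix i j assume "i \<in> set ?xs" "j \<in> set ?xs" "i > j"
    then show "upper_content \<alpha> L i < upper_content \<alpha> L j"
      using pos by (intro upper_content_less[OF \<alpha> L]) auto
  qed
  then show "sorted_wrt (<) (map (upper_content \<alpha> L) ?xs)"
    by (simp only: sorted_wrt_map)
  have "set ?xs = insert 1 (Suc ` corner_rows L)" by (auto simp: corner_list(1))
  then show "set (map (upper_content \<alpha> L) ?xs) = nw_content \<alpha> ` addable L"
    unfolding addable_eq[OF L] image_image nw_content_end set_map by simp
qed

text \<open>Shifting the index of the upper contents by one pairs
  \<open>lower_content \<alpha> L i\<close> with \<open>upper_content \<alpha> L (i + 1)\<close>.
  These agree off the corner rows, so only corners contribute.\<close>

lemma kappa_hook_prod_corners: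
  assumes \<alpha>: "\<alpha> > 0" and L: "young_diagram L" and r: "r \<in> corner_rows L"
  shows "kappa \<alpha> (L - {(r, row_length L r)}) L * hook_prod \<alpha> L /
      hook_prod \<alpha> (L - {(r, row_length L r)}) =
    (upper_content \<alpha> L 1 - lower_content \<alpha> L r) *
    (lower_content \<alpha> L r - upper_content \<alpha> L (r + 1)) *
    (\<Prod>i\<in>corner_rows L - {r}. (lower_content \<alpha> L r - upper_content \<alpha> L (i + 1)) /
       (lower_content \<alpha> L r - lower_content \<alpha> L i))"
proof -
  let ?u = "upper_content \<alpha> L" and ?v = "lower_content \<alpha> L"
  define N where "N = col_length L 1"
  define I where "I = {1..N} - {r}"
  have r1: "r \<in> {1..N}" using r by (auto simp: corner_rows_def N_def)
  have finI: "finite I" by (simp add: I_def)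
  have "inj_on ?v {1..N}" by (rule inj_on_lower_content[OF \<alpha> L]) auto
  then have nz: "?v r \<noteq> ?v i" if "i \<in> I" for i
    using inj_on_eq_iff[of ?v "{1..N}" r i] that r1 by (simp add: I_def)
  have "row_length L (N + 1) = 0"
    using row_length_pos_iff[OF L, of "N + 1"] by (simp add: N_def)
  \<comment> \<open>Hence \<open>?v r + real N\<close> is the factor for the empty row
    \<open>N + 1\<close>, which the shift needs.\<close>
  then have uN: "?u (N + 1) = - real N" by (simp add: upper_content_def)
  have "(?v r + real N) * (\<Prod>i\<in>I. ?v r - ?u i) = - ((?v r - ?u (N + 1)) * (\<Prod>i=1..N. ?v r - ?u i))"
    using prod.remove[OF _ r1, of "\<lambda>i. ?v r - ?u i"]
    unfolding uN by (simp add: I_def upper_content_eq[of _ _ r])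
  also have "\<dots> = - ((?v r - ?u 1) * (\<Prod>i=1..N. ?v r - ?u (i + 1)))"
    using prod_shift_first_last[of "\<lambda>i. ?v r - ?u i" N] by simp
  also have "\<dots> = (?u 1 - ?v r) * (?v r - ?u (r + 1)) * (\<Prod>i\<in>I. ?v r - ?u (i + 1))"
  proof -
    have "(\<Prod>i=1..N. ?v r - ?u (i + 1)) = (?v r - ?u (r + 1)) * (\<Prod>i\<in>I. ?v r - ?u (i + 1))"
      unfolding I_def by (rule prod.remove[OF _ r1]) simp
    then show ?thesis by algebra
  qed
  finally have "kappa \<alpha> (L - {(r, row_length L r)}) L * hook_prod \<alpha> L /
      hook_prod \<alpha> (L - {(r, row_length L r)}) =
    (?u 1 - ?v r) * (?v r - ?u (r + 1)) * (\<Prod>i\<in>I. (?v r - ?u (i + 1)) / (?v r - ?v i))"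
    unfolding kappa_hook_prod[OF \<alpha> L r] I_def N_def prod_dividef by simp
  also have "(\<Prod>i\<in>I. (?v r - ?u (i + 1)) / (?v r - ?v i)) =
      (\<Prod>i\<in>corner_rows L - {r}. (?v r - ?u (i + 1)) / (?v r - ?v i))"
  proof (rule prod.mono_neutral_right[OF finI])
    show "\<forall>i\<in>I - (corner_rows L - {r}). (?v r - ?u (i + 1)) / (?v r - ?v i) = 1"
    proof
      fix i assume i: "i \<in> I - (corner_rows L - {r})"
      then have "?u (i + 1) = ?v i"
        by (intro upper_content_Suc_not_corner[OF L]) (auto simp: I_def)
      then show "(?v r - ?u (i + 1)) / (?v r - ?v i) = 1" using nz[of i] i by simp
    qed
  qed (auto simp: I_def corner_rows_def N_def)
  finally show ?thesis .
qed

theorem theorem6p7: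
  fixes \<alpha> A :: real and \<Lambda> :: "box set" and n d :: nat and x y :: "nat \<Rightarrow> real"
  assumes "\<alpha> > 0"
    and "young_diagram \<Lambda>" and "card \<Lambda> = n" and "n \<ge> 1"
    and "d = card (addable \<Lambda>)"
    and "x = x_seq \<alpha> \<Lambda>" and "y = y_seq \<alpha> \<Lambda>"
    and "A = \<alpha> * real n"
  shows "finite (addable \<Lambda>) \<and> d = card (removable \<Lambda>) + 1 \<and>
    inj_on (se_content \<alpha>) (removable \<Lambda>) \<and> inj_on (nw_content \<alpha>) (addable \<Lambda>) \<and>
    (\<forall>i \<in> {1..d - 1}. x i < y i \<and> y i < x (i + 1)) \<and>
    (\<forall>k \<in> {1..d - 1}. \<forall>b \<in> removable \<Lambda>. \<forall>\<mu>. se_content \<alpha> b = y k \<and> \<mu> = \<Lambda> - {b} \<longrightarrow>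
       kappa \<alpha> \<mu> \<Lambda> * dim_alpha \<alpha> \<mu> / dim_alpha \<alpha> \<Lambda> =
       (x d - y k) * (y k - x 1) / A *
       (\<Prod>i \<in> {1..k - 1}. (y k - x (i + 1)) / (y k - y i)) *
       (\<Prod>j \<in> {k + 1..d - 1}. (y k - x j) / (y k - y j)))"
proof -
  note \<alpha> = assms(1) and L = assms(2)
  let ?u = "upper_content \<alpha> \<Lambda>" and ?v = "lower_content \<alpha> \<Lambda>"
  define m where "m = card (corner_rows \<Lambda>)"
  \<comment> \<open>The row of the \<open>k\<close>-th removable box by content;
    \<open>k - 1\<close> converts counting from 1 to list positions. It decreases in
    \<open>k\<close>.\<close>
  define \<rho> where "\<rho> k = corner_list \<Lambda> ! (k - 1)" for k
  have bij: "bij_betw \<rho> {1..m} (corner_rows \<Lambda>)"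
  proof -
    have "bij_betw (\<lambda>k. k - 1) {1..m} {..<m}"
      by (rule bij_betw_byWitness[of _ Suc]) auto
    moreover have "bij_betw (nth (corner_list \<Lambda>)) {..<m} (corner_rows \<Lambda>)"
      by (rule bij_betw_nth) (auto simp: corner_list m_def)
    ultimately have "bij_betw (nth (corner_list \<Lambda>) \<circ> (\<lambda>k. k - 1)) {1..m} (corner_rows \<Lambda>)"
      by (rule bij_betw_trans)
    then show ?thesis by (simp add: \<rho>_def[abs_def] comp_def)
  qed
  have \<rho>: "\<rho> k \<in> corner_rows \<Lambda>" if "k \<in> {1..m}" for k
    using bij_betwE[OF bij] that by blast
  have \<rho>_pos: "1 \<le> \<rho> k" if "k \<in> {1..m}" for k
    using \<rho>[OF that] corner_rows_iff[OF L] by blast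
  have \<rho>_less: "\<rho> l < \<rho> k" if "k \<in> {1..m}" "l \<in> {1..m}" "k < l" for k l
    using sorted_wrt_nth_less[OF corner_list(4), of "k - 1" "l - 1" \<Lambda>] that
    by (auto simp: \<rho>_def corner_list(3) m_def)
  have y: "y k = ?v (\<rho> k)" if "k \<in> {1..m}" for k
    using that by (auto simp: assms(7) y_seq_def sorted_lower_contents[OF \<alpha> L] \<rho>_def corner_list(3) m_def)
  have x: "x k = ?u (\<rho> k + 1)" if "k \<in> {1..m}" for k
    using that by (auto simp: assms(6) x_seq_def sorted_upper_contents[OF \<alpha> L] \<rho>_def corner_list(3) m_def nth_append)
  have x_last: "x (m + 1) = ?u 1"
    by (simp add: assms(6) x_seq_def sorted_upper_contents[OF \<alpha> L] corner_list(3) m_def nth_append)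
  have corner_pos: "corner_rows \<Lambda> \<subseteq> {1..}" by (auto simp: corner_rows_def)
  have fin: "finite (addable \<Lambda>)"
    using finite_corner_rows by (simp add: addable_eq[OF L])
  have card_rem: "card (removable \<Lambda>) = m"
    unfolding removable_eq[OF L] m_def by (rule card_image) (auto simp: inj_on_def)
  have "card (addable \<Lambda>) = card (insert 1 (Suc ` corner_rows \<Lambda>))"
    unfolding addable_eq[OF L] by (rule card_image) (auto simp: inj_on_def)
  also have "\<dots> = m + 1"
  proof -
    have "1 \<notin> Suc ` corner_rows \<Lambda>" using corner_pos by auto
    then show ?thesis
      using finite_corner_rows[of \<Lambda>] by (simp add: card_image m_def)
  qed
  finally have d: "d = m + 1" using assms(5) by simp
  have inj_se: "inj_on (se_content \<alpha>) (removable \<Lambda>)"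
    unfolding removable_eq[OF L]
    using inj_on_lower_content[OF \<alpha> L corner_pos]
    by (intro inj_on_imageI) (simp add: comp_def se_content_corner)
  have inj_nw: "inj_on (nw_content \<alpha>) (addable \<Lambda>)"
  proof -
    have "insert 1 (Suc ` corner_rows \<Lambda>) \<subseteq> {1..}" by auto
    from inj_on_upper_content[OF \<alpha> L this] show ?thesis
      unfolding addable_eq[OF L] by (intro inj_on_imageI) (simp only: comp_def nw_content_end)
  qed
  have interlace: "x i < y i \<and> y i < x (i + 1)" if i: "i \<in> {1..m}" for i
  proof
    show "x i < y i"
      using upper_content_Suc_corner[OF \<alpha> L \<rho>[OF i]] i by (simp add: x y)
    \<comment> \<open>The upper end of the edge at \<open>\<rho> i\<close> lies above
      \<open>y i\<close> by 1 and is at most the next \<open>x\<close>, as the next addable row is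
      no lower than \<open>\<rho> i\<close>.\<close>
    have less: "?v (\<rho> i) < ?u (\<rho> i)" by (simp add: upper_content_eq)
    show "y i < x (i + 1)"
    proof (cases "i = m")
      case True
      have "?u (\<rho> i) \<le> ?u 1"
        using upper_content_less[OF \<alpha> L, of 1 "\<rho> i"] \<rho>_pos[OF i] by (cases "\<rho> i = 1") auto
      then show ?thesis using i x_last True less by (simp add: y)
    next
      case False
      then have i': "i + 1 \<in> {1..m}" using i by auto
      have "?u (\<rho> i) \<le> ?u (\<rho> (i + 1) + 1)"
        using upper_content_less[OF \<alpha> L, of "\<rho> (i + 1) + 1" "\<rho> i"] \<rho>_less[OF i i']
        by (cases "\<rho> i = \<rho> (i + 1) + 1") auto
      then show ?thesis
        unfolding y[OF i] x[OF i'] using less by simp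
    qed
  qed
  have formula: "kappa \<alpha> (\<Lambda> - {b}) \<Lambda> * dim_alpha \<alpha> (\<Lambda> - {b}) / dim_alpha \<alpha> \<Lambda> =
       (x d - y k) * (y k - x 1) / A *
       (\<Prod>i \<in> {1..k - 1}. (y k - x (i + 1)) / (y k - y i)) *
       (\<Prod>j \<in> {k + 1..d - 1}. (y k - x j) / (y k - y j))"
    if k: "k \<in> {1..m}" and b: "b \<in> removable \<Lambda>" and bk: "se_content \<alpha> b = y k" for k b
  proof -
    have "(\<rho> k, row_length \<Lambda> (\<rho> k)) \<in> removable \<Lambda>"
      using \<rho>[OF k] removable_iff[OF L] by simp
    then have b_eq: "b = (\<rho> k, row_length \<Lambda> (\<rho> k))"
      using inj_onD[OF inj_se, OF _ b] bk y[OF k] se_content_corner by metis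
    have "kappa \<alpha> (\<Lambda> - {b}) \<Lambda> * dim_alpha \<alpha> (\<Lambda> - {b}) / dim_alpha \<alpha> \<Lambda> =
        (x d - y k) * (y k - x k) *
        (\<Prod>i\<in>corner_rows \<Lambda> - {\<rho> k}. (y k - ?u (i + 1)) / (y k - ?v i)) / A"
      using kappa_dim_alpha_ratio[OF \<alpha> L \<rho>[OF k]] kappa_hook_prod_corners[OF \<alpha> L \<rho>[OF k]]
        x_last by (simp add: b_eq assms(3,8) d x[OF k] y[OF k])
    also have "(\<Prod>i\<in>corner_rows \<Lambda> - {\<rho> k}. (y k - ?u (i + 1)) / (y k - ?v i)) =
        (\<Prod>i\<in>{1..m} - {k}. (y k - ?u (\<rho> i + 1)) / (y k - ?v (\<rho> i)))"
    proof (rule prod.reindex_bij_betw[symmetric])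
      show "bij_betw \<rho> ({1..m} - {k}) (corner_rows \<Lambda> - {\<rho> k})"
        using bij_betw_imp_inj_on[OF bij] bij_betw_imp_surj_on[OF bij] k
          inj_on_image_set_diff[of \<rho> "{1..m}" "{1..m}" "{k}"]
        unfolding bij_betw_def by (auto intro: inj_on_subset)
    qed
    also have "\<dots> = (\<Prod>i\<in>{1..k - 1} \<union> {k + 1..m}. (y k - x i) / (y k - y i))"
      using k by (intro prod.cong) (auto simp: x y)
    also have "\<dots> = (\<Prod>i=1..k - 1. (y k - x i) / (y k - y i)) *
        (\<Prod>i=k + 1..m. (y k - x i) / (y k - y i))"
      by (rule prod.union_disjoint) auto
    finally have eq: "kappa \<alpha> (\<Lambda> - {b}) \<Lambda> * dim_alpha \<alpha> (\<Lambda> - {b}) / dim_alpha \<alpha> \<Lambda> =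
        (x d - y k) * ((y k - x k) * (\<Prod>i=1..k - 1. (y k - x i) / (y k - y i))) / A *
        (\<Prod>i=k + 1..m. (y k - x i) / (y k - y i))"
      by simp
    \<comment> \<open>For indices below \<open>k\<close>, absorbing \<open>y k - x k\<close> turns
      each \<open>x i\<close> into \<open>x (i + 1)\<close> and releases
      \<open>y k - x 1\<close>.\<close>
    have "(y k - x k) * (\<Prod>i=1..k - 1. (y k - x i) / (y k - y i)) =
        (y k - x 1) * (\<Prod>i=1..k - 1. (y k - x (i + 1)) / (y k - y i))"
      using prod_shift_first_last[of "\<lambda>i. y k - x i" "k - 1"] k
      unfolding prod_dividef times_divide_eq_right by simp
    then show ?thesis unfolding eq by (simp add: d)
  qed
  show ?thesis
    using fin card_rem d inj_se inj_nw interlace formula by simp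
qed

end
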